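(* Let $\mathrm{DS} = \{\langle e,x,u\rangle : (\forall y)[L^e_x \neq L^e_y \rightarrow L^e_x \cap D_u \neq L^e_y \cap D_u]\}$ and let $\mathrm{TDDP} = \{\langle e,x,d\rangle : d \geq 1 \wedge (\exists u)[\,|D_u| \leq d \wedge \langle e,x,u\rangle \in \mathrm{DS}]\}$. Then $\mathrm{TDDP}$ is $\Sigma^0_3$-complete.
   Context: $W_0,W_1,\ldots$ is an acceptable numbering of all r.e. subsets of $\mathbb N$, and $\langle\cdot,\cdot\rangle$ (and its iterates) is a standard recursive pairing function. For all $e,j$, $L^e_j = \{x : \langle j,x\rangle \in W_e\}$ and $\mathcal L_e = \{L^e_j : j\in\mathbb N\}$. $D_0,D_1,\ldots$ is the canonical numbering of finite sets: $D_0=\emptyset$ and $D_{2^{x_1}+\cdots+2^{x_n}} = \{x_1,\ldots,x_n\}$ for pairwise distinct $x_i$. $\Sigma^0_n$-complete means definable by a $\Sigma^0_n$ formula and every $\Sigma^0_n$ set many-one reduces to it via a recursive function. *)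

theory Defs
  imports Main "HOL-Library.Nat_Bijection"
begin

text \<open>
  The general recursive functions of arity \<open>n\<close>: minimisation is restricted to regular functions,
  so that every function in the class is total. An \<open>n\<close>-ary function is represented by its action
  on lists of length \<open>n\<close>; by the rule \<open>ext\<close>, values on lists of other lengths are irrelevant.
\<close>

inductive recursive :: "nat \<Rightarrow> (nat list \<Rightarrow> nat) \<Rightarrow> bool" where
  zero: "recursive n (\<lambda>xs. 0)"
| succ: "recursive 1 (\<lambda>xs. Suc (xs ! 0))"
| proj: "i < n \<Longrightarrow> recursive n (\<lambda>xs. xs ! i)"
| comp: "recursive (length fs) g \<Longrightarrow> \<forall>f\<in>set fs. recursive n f \<Longrightarrow>
    recursive n (\<lambda>xs. g (map (\<lambda>f. f xs) fs))"
| prim_rec: "recursive n g \<Longrightarrow> recursive (Suc (Suc n)) h \<Longrightarrow>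
    recursive (Suc n) (\<lambda>xs. rec_nat (g (tl xs)) (\<lambda>k r. h (k # r # tl xs)) (hd xs))"
| minimise: "recursive (Suc n) g \<Longrightarrow> \<forall>xs. length xs = n \<longrightarrow> (\<exists>y. g (y # xs) = 0) \<Longrightarrow>
    recursive n (\<lambda>xs. LEAST y. g (y # xs) = 0)"
| ext: "recursive n f \<Longrightarrow> \<forall>xs. length xs = n \<longrightarrow> f xs = g xs \<Longrightarrow> recursive n g"

definition recursive_fun :: "(nat \<Rightarrow> nat) \<Rightarrow> bool" where
  "recursive_fun f \<longleftrightarrow> recursive 1 (\<lambda>xs. f (xs ! 0))"

definition recursive_rel :: "nat \<Rightarrow> (nat list \<Rightarrow> bool) \<Rightarrow> bool" where
  "recursive_rel n R \<longleftrightarrow> recursive n (\<lambda>xs. if R xs then 1 else 0)"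

definition re_set :: "nat set \<Rightarrow> bool" where
  "re_set A \<longleftrightarrow> A = {} \<or> (\<exists>f. recursive_fun f \<and> A = range f)"

text \<open>
  A numbering of the r.e. sets is acceptable if it is uniformly r.e. and every uniformly r.e.
  sequence of sets can be translated into it effectively. That every \<open>W e\<close> is r.e. and that every
  r.e. set occurs as some \<open>W e\<close> are consequences.
\<close>

definition acceptable_numbering :: "(nat \<Rightarrow> nat set) \<Rightarrow> bool" where
  "acceptable_numbering W \<longleftrightarrow>
     re_set {prod_encode (e, x) | e x. x \<in> W e} \<and>
     (\<forall>V. re_set V \<longrightarrow>
        (\<exists>f. recursive_fun f \<and> (\<forall>e. W (f e) = {x. prod_encode (e, x) \<in> V})))"

text \<open>
  \<open>alternating True n R [x]\<close> is \<open>\<exists>y\<^sub>1. \<forall>y\<^sub>2. \<exists>y\<^sub>3. \<dots> R [x, y\<^sub>1, \<dots>, y\<^sub>n]\<close>, with \<open>n\<close> alternating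
  quantifiers; for \<open>False\<close> the prefix starts with a universal quantifier.
\<close>

primrec alternating :: "bool \<Rightarrow> nat \<Rightarrow> (nat list \<Rightarrow> bool) \<Rightarrow> nat list \<Rightarrow> bool" where
  "alternating q 0 R xs = R xs"
| "alternating q (Suc n) R xs =
     (if q then \<exists>y. alternating False n R (xs @ [y]) else \<forall>y. alternating True n R (xs @ [y]))"

definition sigma0 :: "nat \<Rightarrow> nat set \<Rightarrow> bool" where
  "sigma0 n A \<longleftrightarrow> (\<exists>R. recursive_rel (Suc n) R \<and> (\<forall>x. x \<in> A \<longleftrightarrow> alternating True n R [x]))"

definition many_one_reducible :: "nat set \<Rightarrow> nat set \<Rightarrow> bool" where
  "many_one_reducible A B \<longleftrightarrow> (\<exists>f. recursive_fun f \<and> (\<forall>x. x \<in> A \<longleftrightarrow> f x \<in> B))"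

definition sigma0_complete :: "nat \<Rightarrow> nat set \<Rightarrow> bool" where
  "sigma0_complete n A \<longleftrightarrow> sigma0 n A \<and> (\<forall>B. sigma0 n B \<longrightarrow> many_one_reducible B A)"

definition triple :: "nat \<Rightarrow> nat \<Rightarrow> nat \<Rightarrow> nat" where
  "triple x y z = prod_encode (x, prod_encode (y, z))"

definition lang :: "(nat \<Rightarrow> nat set) \<Rightarrow> nat \<Rightarrow> nat \<Rightarrow> nat set" where
  "lang W e j = {x. prod_encode (j, x) \<in> W e}"

text \<open>The canonical numbering \<open>D\<^sub>u\<close> of the finite sets is \<open>set_decode\<close>.\<close>

definition DS :: "(nat \<Rightarrow> nat set) \<Rightarrow> nat set" where
  "DS W = {triple e x u | e x u.
     \<forall>y. lang W e x \<noteq> lang W e y \<longrightarrow>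
       lang W e x \<inter> set_decode u \<noteq> lang W e y \<inter> set_decode u}"

definition TDDP :: "(nat \<Rightarrow> nat set) \<Rightarrow> nat set" where
  "TDDP W = {triple e x d | e x d.
     d \<ge> 1 \<and> (\<exists>u. card (set_decode u) \<le> d \<and> triple e x u \<in> DS W)}"

end

theory Submission imports Defs begin

text \<open>
  Membership: writing \<open>L\<^bsub>x,s\<^esub>\<close> for the part of \<open>L\<^sub>x\<close> enumerated before stage \<open>s\<close>, the set \<open>D\<^sub>u\<close>
  distinguishes \<open>L\<^sub>x\<close> from \<open>L\<^sub>y\<close> unless they are equal if and only if for all \<open>z\<close> and \<open>s\<close> there is
  \<open>t \<ge> s\<close> such that \<open>L\<^bsub>x,t\<^esub>\<close> and \<open>L\<^bsub>y,t\<^esub>\<close> differ on \<open>D\<^sub>u\<close>, or each of \<open>L\<^bsub>x,t\<^esub>\<close>, \<open>L\<^bsub>y,t\<^esub>\<close> contains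
  \<open>z\<close> as soon as the other one contains it at stage \<open>s\<close>.

  Hardness: let \<open>x \<in> B\<close> be equivalent to \<open>\<exists>a. \<forall>b. \<exists>c. R x a b c\<close>. Let \<open>L\<^sub>0\<close> be the set of all numbers and
  \<open>L\<^bsub>a+1\<^esub> = {a} \<union> {n. \<exists>a'\<le>a. \<forall>b\<le>n. \<exists>c. R x a' b c}\<close>. If some \<open>a\<close> is a witness for \<open>x \<in> B\<close>, then
  only finitely many of these sets differ from \<open>L\<^sub>0\<close>, and those are finite, so \<open>{z}\<close> distinguishes them
  from \<open>L\<^sub>0\<close> for \<open>z\<close> large. Otherwise every \<open>L\<^bsub>a+1\<^esub>\<close> is finite and contains \<open>a\<close>, so no set with
  at most one element works.
\<close>

section \<open>Closure properties of the recursive functions\<close>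

lemma recursive_cong:
  "recursive n f \<Longrightarrow> (\<And>xs. length xs = n \<Longrightarrow> f xs = g xs) \<Longrightarrow> recursive n g"
  by (blast intro: recursive.ext)

lemma recursive_comp_fun:
  assumes "recursive_fun g" "recursive n f"
  shows "recursive n (\<lambda>xs. g (f xs))"
  using recursive.comp[of "[f]" "\<lambda>xs. g (xs ! 0)" n] assms by (simp add: recursive_fun_def)

text \<open>The closure rules below address arguments through \<open>hd\<close> and
  \<open>tl\<close>; this brings the \<open>xs ! 0\<close> of \<open>recursive_fun\<close> into that
  form.\<close>

lemma recursive_fun_iff: "recursive_fun f \<longleftrightarrow> recursive 1 (\<lambda>xs. f (hd xs))"
proof -
  have "xs ! 0 = hd xs" if "length xs = 1" for xs :: "nat list"
    using that by (cases xs) auto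
  then show ?thesis
    unfolding recursive_fun_def by (auto elim!: recursive_cong)
qed

lemma recursive_funI: "recursive 1 (\<lambda>xs. f (hd xs)) \<Longrightarrow> recursive_fun f"
  by (simp add: recursive_fun_iff)

lemma recursive_Suc: "recursive n f \<Longrightarrow> recursive n (\<lambda>xs. Suc (f xs))"
  using recursive_comp_fun[of Suc] recursive.succ by (simp add: recursive_fun_def)

lemma recursive_const: "recursive n (\<lambda>xs. c)"
  by (induction c) (auto intro: recursive.zero recursive_Suc)

text \<open>The coordinates of \<open>h xs\<close> serve as the inner functions of a composition, so
  a list-valued \<open>h\<close> acts as a tuple. Dropping, inserting and rearranging arguments are
  instances.\<close>

lemma recursive_comp_list:
  assumes "recursive m f"
    and len: "\<And>xs. length xs = n \<Longrightarrow> length (h xs) = m"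
    and nth: "\<And>i. i < m \<Longrightarrow> recursive n (\<lambda>xs. h xs ! i)"
  shows "recursive n (\<lambda>xs. f (h xs))"
proof -
  let ?fs = "map (\<lambda>i xs. h xs ! i) [0..<m]"
  have "recursive n (\<lambda>xs. f (map (\<lambda>g. g xs) ?fs))"
    using recursive.comp[of ?fs f n] assms(1) nth by simp
  then show ?thesis
  proof (rule recursive_cong)
    fix xs :: "nat list" assume "length xs = n"
    then have "length (h xs) = m" by (rule len)
    then have "map (\<lambda>g. g xs) ?fs = h xs"
      by (intro nth_equalityI) simp_all
    then show "f (map (\<lambda>g. g xs) ?fs) = f (h xs)" by simp
  qed
qed

lemma recursive_tl:
  assumes "recursive n f"
  shows "recursive (Suc n) (\<lambda>xs. f (tl xs))"
proof (rule recursive_comp_list[OF assms])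
  fix i assume "i < n"
  then have "recursive (Suc n) (\<lambda>xs. xs ! Suc i)"
    by (auto intro: recursive.proj)
  then show "recursive (Suc n) (\<lambda>xs. tl xs ! i)"
    using \<open>i < n\<close> by (auto elim!: recursive_cong simp: nth_tl)
qed auto

lemma recursive_hd: "recursive (Suc n) hd"
  by (rule recursive_cong[OF recursive.proj[of 0]]) (auto simp: length_Suc_conv)

text \<open>Bound variables live at the head of the argument list: \<open>g (hd xs) (tl xs)\<close>
  is \<open>g\<close> with one extra argument in front. Here that argument is filled in; recursion,
  sums and bounded quantifiers use the same convention.\<close>

lemma recursive_subst:
  assumes "recursive (Suc n) (\<lambda>xs. g (hd xs) (tl xs))" and "recursive n f"
  shows "recursive n (\<lambda>xs. g (f xs) xs)"
proof -
  have "recursive n (\<lambda>xs. g (hd (f xs # xs)) (tl (f xs # xs)))"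
  proof (rule recursive_comp_list[OF assms(1)])
    show "recursive n (\<lambda>xs. (f xs # xs) ! i)" if "i < Suc n" for i
      using that assms(2) by (cases i) (auto intro: recursive.proj)
  qed auto
  then show ?thesis by simp
qed

text \<open>The step function of a recursion receives the counter, the previous value and the
  parameters; this skips the previous value.\<close>

lemma recursive_tl_tl:
  assumes "recursive (Suc n) (\<lambda>xs. g (hd xs) (tl xs))"
  shows "recursive (Suc (Suc n)) (\<lambda>xs. g (hd xs) (tl (tl xs)))"
proof -
  have "recursive (Suc (Suc n)) (\<lambda>xs. g (hd (hd xs # tl (tl xs))) (tl (hd xs # tl (tl xs))))"
  proof (rule recursive_comp_list[OF assms])
    show "recursive (Suc (Suc n)) (\<lambda>xs. (hd xs # tl (tl xs)) ! i)" if "i < Suc n" for i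
      using that recursive_tl[OF recursive_tl[OF recursive.proj]]
      by (cases i) (auto intro: recursive_hd)
  qed auto
  then show ?thesis by simp
qed

lemma recursive_rec_nat:
  assumes "recursive n g"
    and "recursive (Suc (Suc n)) (\<lambda>xs. h (hd xs) (hd (tl xs)) (tl (tl xs)))"
    and "recursive n b"
  shows "recursive n (\<lambda>xs. rec_nat (g xs) (\<lambda>k r. h k r xs) (b xs))"
proof (rule recursive_subst[where g="\<lambda>m xs. rec_nat (g xs) (\<lambda>k r. h k r xs) m"])
  show "recursive (Suc n) (\<lambda>xs. rec_nat (g (tl xs)) (\<lambda>k r. h k r (tl xs)) (hd xs))"
    using recursive.prim_rec[OF assms(1,2)] by simp
qed (fact assms)

section \<open>Arithmetic operations and the pairing function\<close>

lemma recursive_add: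
  assumes "recursive n f" "recursive n g"
  shows "recursive n (\<lambda>xs. f xs + g xs)"
proof -
  have "rec_nat a (\<lambda>k r. Suc r) b = a + b" for a b :: nat
    by (induction b) auto
  moreover have "recursive n (\<lambda>xs. rec_nat (f xs) (\<lambda>k r. Suc r) (g xs))"
    by (intro recursive_rec_nat recursive_Suc recursive_tl recursive_hd assms)
  ultimately show ?thesis by simp
qed

lemma recursive_diff:
  assumes "recursive n f" "recursive n g"
  shows "recursive n (\<lambda>xs. f xs - g xs)"
proof -
  have pred: "recursive n (\<lambda>xs. f xs - 1)" if "recursive n f" for n f
  proof -
    have "rec_nat 0 (\<lambda>k r. k) b = b - 1" for b :: nat
      by (cases b) auto
    moreover have "recursive n (\<lambda>xs. rec_nat 0 (\<lambda>k r. k) (f xs))"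
      by (intro recursive_rec_nat recursive_const recursive_hd that)
    ultimately show ?thesis by simp
  qed
  have "rec_nat a (\<lambda>k r. r - 1) b = a - b" for a b :: nat
    by (induction b) auto
  moreover have "recursive n (\<lambda>xs. rec_nat (f xs) (\<lambda>k r. r - 1) (g xs))"
    by (intro recursive_rec_nat pred recursive_tl recursive_hd assms)
  ultimately show ?thesis by simp
qed

lemma recursive_sum:
  assumes "recursive (Suc n) (\<lambda>xs. g (hd xs) (tl xs))" "recursive n b"
  shows "recursive n (\<lambda>xs. \<Sum>i<b xs. g i xs)"
proof -
  have "rec_nat 0 (\<lambda>k r. r + g k xs) m = (\<Sum>i<m. g i xs)" for m xs
    by (induction m) auto
  moreover have "recursive n (\<lambda>xs. rec_nat 0 (\<lambda>k r. r + g k xs) (b xs))"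
  proof (rule recursive_rec_nat)
    show "recursive (Suc (Suc n)) (\<lambda>xs. hd (tl xs) + g (hd xs) (tl (tl xs)))"
      by (rule recursive_add[OF recursive_tl[OF recursive_hd] recursive_tl_tl[OF assms(1)]])
  qed (fact recursive_const assms(2))+
  ultimately show ?thesis by simp
qed

lemma recursive_mult:
  assumes "recursive n f" "recursive n g"
  shows "recursive n (\<lambda>xs. f xs * g xs)"
proof -
  have "recursive n (\<lambda>xs. \<Sum>i<f xs. g xs)"
    by (intro recursive_sum recursive_tl assms)
  then show ?thesis by simp
qed

lemma recursive_power2:
  assumes "recursive n f"
  shows "recursive n (\<lambda>xs. 2 ^ f xs)"
proof -
  have "rec_nat 1 (\<lambda>k r. r + r) b = (2::nat) ^ b" for b :: nat
    by (induction b) auto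
  moreover have "recursive n (\<lambda>xs. rec_nat 1 (\<lambda>k r. r + r) (f xs))"
    by (intro recursive_rec_nat recursive_const recursive_add recursive_tl recursive_hd assms)
  ultimately show ?thesis by simp
qed

lemma recursive_prod_encode:
  assumes "recursive n f" "recursive n g"
  shows "recursive n (\<lambda>xs. prod_encode (f xs, g xs))"
proof -
  \<comment> \<open>Writing the triangle number as a sum avoids the division in its
    definition.\<close>
  have "triangle m = (\<Sum>i<Suc m. i)" for m
    by (induction m) auto
  then have encode: "prod_encode (a, b) = (\<Sum>i<Suc (a + b). i) + a" for a b
    unfolding prod_encode_def by simp
  show ?thesis
    unfolding encode
    by (intro recursive_sum recursive_add recursive_Suc recursive_hd assms)
qed

section \<open>Recursive relations\<close>

lemma recursive_rel_positive:
  assumes "recursive n f"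
  shows "recursive_rel n (\<lambda>xs. 0 < f xs)"
proof -
  \<comment> \<open>With truncated subtraction this is the sign of \<open>f xs\<close>.\<close>
  have "recursive n (\<lambda>xs. 1 - (1 - f xs))"
    using assms by (intro recursive_diff recursive_const)
  then show ?thesis
    unfolding recursive_rel_def by (rule recursive_cong) auto
qed

lemma recursive_rel_less:
  assumes "recursive n f" "recursive n g"
  shows "recursive_rel n (\<lambda>xs. f xs < g xs)"
  using recursive_rel_positive[OF recursive_diff[OF assms(2,1)]] by simp

lemma recursive_rel_not:
  assumes "recursive_rel n P"
  shows "recursive_rel n (\<lambda>xs. \<not> P xs)"
  using recursive_rel_positive[OF recursive_diff[OF recursive_const[of n 1] assms[unfolded recursive_rel_def]]]
  by (auto simp: recursive_rel_def elim!: recursive_cong)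

lemma recursive_rel_conj:
  assumes "recursive_rel n P" "recursive_rel n Q"
  shows "recursive_rel n (\<lambda>xs. P xs \<and> Q xs)"
  using recursive_mult[OF assms[unfolded recursive_rel_def]]
  by (auto simp: recursive_rel_def elim!: recursive_cong)

lemma recursive_rel_disj:
  assumes "recursive_rel n P" "recursive_rel n Q"
  shows "recursive_rel n (\<lambda>xs. P xs \<or> Q xs)"
  using recursive_rel_not[OF recursive_rel_conj[OF assms[THEN recursive_rel_not]]] by simp

lemma recursive_rel_imp:
  assumes "recursive_rel n P" "recursive_rel n Q"
  shows "recursive_rel n (\<lambda>xs. P xs \<longrightarrow> Q xs)"
  using recursive_rel_disj[OF recursive_rel_not[OF assms(1)] assms(2)] by simp

lemma recursive_rel_iff:
  assumes "recursive_rel n P" "recursive_rel n Q"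
  shows "recursive_rel n (\<lambda>xs. P xs \<longleftrightarrow> Q xs)"
  unfolding iff_conv_conj_imp by (intro recursive_rel_conj recursive_rel_imp assms)

lemma recursive_rel_le:
  assumes "recursive n f" "recursive n g"
  shows "recursive_rel n (\<lambda>xs. f xs \<le> g xs)"
  using recursive_rel_not[OF recursive_rel_less[OF assms(2,1)]] by (simp add: not_less)

lemma recursive_rel_eq:
  assumes "recursive n f" "recursive n g"
  shows "recursive_rel n (\<lambda>xs. f xs = g xs)"
  using recursive_rel_conj[OF recursive_rel_le[OF assms] recursive_rel_le[OF assms(2,1)]]
  by (simp add: eq_iff)

lemma recursive_rel_ex:
  assumes "recursive_rel (Suc n) (\<lambda>xs. P (hd xs) (tl xs))" "recursive n b"
  shows "recursive_rel n (\<lambda>xs. \<exists>i<b xs. P i xs)"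
proof -
  \<comment> \<open>The sum counts the witnesses below the bound.\<close>
  have "recursive n (\<lambda>xs. \<Sum>i<b xs. if P i xs then 1 else 0)"
    using assms by (intro recursive_sum) (simp_all add: recursive_rel_def)
  from recursive_rel_positive[OF this] show ?thesis
    by (auto simp: recursive_rel_def sum_pos2 elim!: recursive_cong)
qed

lemma recursive_rel_all:
  assumes "recursive_rel (Suc n) (\<lambda>xs. P (hd xs) (tl xs))" "recursive n b"
  shows "recursive_rel n (\<lambda>xs. \<forall>i<b xs. P i xs)"
  using recursive_rel_not[OF recursive_rel_ex[OF recursive_rel_not[OF assms(1)] assms(2)]] by simp

lemma recursive_if:
  assumes "recursive_rel n P" "recursive n f" "recursive n g"
  shows "recursive n (\<lambda>xs. if P xs then f xs else g xs)"
proof -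
  have "recursive n (\<lambda>xs. (if P xs then 1 else 0) * f xs + (if \<not> P xs then 1 else 0) * g xs)"
    using assms recursive_rel_not[OF assms(1)]
    by (intro recursive_add recursive_mult) (simp_all add: recursive_rel_def)
  then show ?thesis by (rule recursive_cong) auto
qed

lemma recursive_rel_comp_list:
  assumes "recursive_rel m P"
    and "\<And>xs. length xs = n \<Longrightarrow> length (h xs) = m"
    and "\<And>i. i < m \<Longrightarrow> recursive n (\<lambda>xs. h xs ! i)"
  shows "recursive_rel n (\<lambda>xs. P (h xs))"
  using assms unfolding recursive_rel_def by (rule recursive_comp_list)

text \<open>The value is found by unbounded search through the graph. The search is regular because
  \<open>f xs\<close> itself ends it.\<close>

lemma recursive_of_graph:
  assumes "recursive_rel (Suc n) (\<lambda>xs. hd xs = f (tl xs))"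
  shows "recursive n f"
proof -
  let ?g = "\<lambda>xs. if \<not> hd xs = f (tl xs) then 1 else (0::nat)"
  have "recursive n (\<lambda>xs. LEAST y. ?g (y # xs) = 0)"
    using recursive_rel_not[OF assms]
    by (intro recursive.minimise) (auto simp: recursive_rel_def)
  then show ?thesis
    by (rule recursive_cong) (auto intro!: Least_equality split: if_splits)
qed

section \<open>Decoding of pairs and of canonical indices\<close>

lemma recursive_fst:
  assumes "recursive n f"
  shows "recursive n (\<lambda>xs. fst (prod_decode (f xs)))"
proof (rule recursive_of_graph)
  \<comment> \<open>No component exceeds the code of the pair, which bounds the search for the other
    component.\<close>
  have "a = fst (prod_decode v) \<longleftrightarrow> (\<exists>b<Suc v. prod_encode (a, b) = v)" for a v
    using le_prod_encode_2[of "snd (prod_decode v)" "fst (prod_decode v)"]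
    by (auto intro!: exI[of _ "snd (prod_decode v)"])
  moreover have "recursive_rel (Suc n)
      (\<lambda>xs. \<exists>b<Suc (f (tl xs)). prod_encode (hd xs, b) = f (tl xs))"
    using assms by (intro recursive_rel_ex recursive_rel_eq recursive_prod_encode recursive_Suc
        recursive_hd recursive_tl)
  ultimately show "recursive_rel (Suc n) (\<lambda>xs. hd xs = fst (prod_decode (f (tl xs))))"
    by simp
qed

lemma recursive_snd:
  assumes "recursive n f"
  shows "recursive n (\<lambda>xs. snd (prod_decode (f xs)))"
proof (rule recursive_of_graph)
  have "b = snd (prod_decode v) \<longleftrightarrow> (\<exists>a<Suc v. prod_encode (a, b) = v)" for b v
    using le_prod_encode_1[of "fst (prod_decode v)" "snd (prod_decode v)"]
    by (auto intro!: exI[of _ "fst (prod_decode v)"])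
  moreover have "recursive_rel (Suc n)
      (\<lambda>xs. \<exists>a<Suc (f (tl xs)). prod_encode (a, hd xs) = f (tl xs))"
    using assms by (intro recursive_rel_ex recursive_rel_eq recursive_prod_encode recursive_Suc
        recursive_hd recursive_tl)
  ultimately show "recursive_rel (Suc n) (\<lambda>xs. hd xs = snd (prod_decode (f (tl xs))))"
    by simp
qed

lemma recursive_rel_set_decode:
  assumes "recursive n f" "recursive n g"
  shows "recursive_rel n (\<lambda>xs. f xs \<in> set_decode (g xs))"
proof -
  \<comment> \<open>\<open>q\<close> holds the binary digits of \<open>u\<close> above position
    \<open>w\<close>, \<open>r\<close> those below it, and the digit at \<open>w\<close> is the 1 in
    \<open>2 * q + 1\<close>.\<close>
  have "w \<in> set_decode u \<longleftrightarrow> (\<exists>q<Suc u. \<exists>r<2 ^ w. u = (2 * q + 1) * 2 ^ w + r)" for w u :: nat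
  proof
    assume "w \<in> set_decode u"
    then obtain q where q: "u div 2 ^ w = 2 * q + 1"
      by (auto simp: set_decode_def elim: oddE)
    then have "u = (2 * q + 1) * 2 ^ w + u mod 2 ^ w"
      by (metis div_mult_mod_eq)
    moreover have "q < Suc u"
      using q div_le_dividend[of u "2 ^ w"] by simp
    ultimately show "\<exists>q<Suc u. \<exists>r<2 ^ w. u = (2 * q + 1) * 2 ^ w + r"
      by (metis mod_less_divisor zero_less_numeral zero_less_power)
  next
    assume "\<exists>q<Suc u. \<exists>r<2 ^ w. u = (2 * q + 1) * 2 ^ w + r"
    then obtain q r where "r < 2 ^ w" "u = (2 * q + 1) * 2 ^ w + r" by blast
    then have "u div 2 ^ w = 2 * q + 1"
      by (metis add.commute add.right_neutral div_less div_mult_self1 less_nat_zero_code power_not_zero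
          zero_neq_numeral)
    then show "w \<in> set_decode u" by (simp add: set_decode_def)
  qed
  moreover have "recursive_rel n
      (\<lambda>xs. \<exists>q<Suc (g xs). \<exists>r<2 ^ f xs. g xs = (2 * q + 1) * 2 ^ f xs + r)"
    using assms
    by (intro recursive_rel_ex recursive_rel_eq recursive_add recursive_mult recursive_power2
        recursive_Suc recursive_const recursive_hd recursive_tl)
  ultimately show ?thesis by simp
qed

text \<open>A digit at position \<open>w\<close> contributes \<open>2 ^ w > w\<close>. This turns
  quantifiers and sums over \<open>set_decode u\<close> into bounded ones.\<close>

lemma set_decode_less: "w \<in> set_decode u \<Longrightarrow> w < u"
proof -
  assume "w \<in> set_decode u"
  then have "u div 2 ^ w \<noteq> 0" by (metis even_zero mem_Collect_eq set_decode_def)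
  then have "2 ^ w \<le> u" by (metis div_less not_le)
  then show "w < u" using less_exp[of w] by linarith
qed

lemma card_set_decode: "card (set_decode u) = (\<Sum>w<u. if w \<in> set_decode u then 1 else 0)"
proof -
  have "set_decode u = {w \<in> {..<u}. w \<in> set_decode u}"
    using set_decode_less by auto
  then have "card (set_decode u) = card {w \<in> {..<u}. w \<in> set_decode u}" by simp
  then show ?thesis by (simp add: sum.If_cases Int_def)
qed

lemma recursive_card_set_decode:
  assumes "recursive n f"
  shows "recursive n (\<lambda>xs. card (set_decode (f xs)))"
  unfolding card_set_decode using assms
  by (intro recursive_sum recursive_if recursive_rel_set_decode recursive_const recursive_hd
      recursive_tl)

section \<open>R.e. sets\<close>

text \<open>Given an enumeration, \<open>s\<close> is an argument at which it takes the value
  \<open>v\<close>. Conversely, running through all codes of pairs and returning the first component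
  of those accepted by \<open>Q\<close> enumerates \<open>A\<close>.\<close>

lemma re_set_ex_iff:
  "re_set A \<longleftrightarrow> (\<exists>Q. recursive_rel 1 Q \<and> (\<forall>v. v \<in> A \<longleftrightarrow> (\<exists>s. Q [prod_encode (v, s)])))"
  (is "_ \<longleftrightarrow> ?R")
proof
  assume "re_set A"
  then consider "A = {}" | f where "recursive_fun f" "A = range f"
    by (auto simp: re_set_def)
  then show ?R
  proof cases
    case 1
    have "recursive_rel 1 (\<lambda>_. False)"
      by (simp add: recursive_rel_def recursive.zero)
    with 1 show ?thesis by blast
  next
    case 2
    let ?Q = "\<lambda>xs. fst (prod_decode (hd xs)) = f (snd (prod_decode (hd xs)))"
    have "recursive_rel 1 ?Q"
      unfolding One_nat_def
      by (intro recursive_rel_eq recursive_comp_fun[OF 2(1)] recursive_fst recursive_snd recursive_hd)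
    moreover have "\<forall>v. v \<in> A \<longleftrightarrow> (\<exists>s. ?Q [prod_encode (v, s)])"
      using 2 by auto
    ultimately show ?thesis by blast
  qed
next
  assume ?R
  then obtain Q where Q: "recursive_rel 1 Q" "\<And>v. v \<in> A \<longleftrightarrow> (\<exists>s. Q [prod_encode (v, s)])"
    by blast
  show "re_set A"
  proof (cases "A = {}")
    case False
    then obtain a where a: "a \<in> A" by blast
    \<comment> \<open>Rejected codes are sent to the fixed element \<open>a\<close>, so the range
      stays inside \<open>A\<close>; hence the separate case of the empty set.\<close>
    define f where "f = (\<lambda>w. if Q [w] then fst (prod_decode w) else a)"
    have "recursive 1 (\<lambda>xs. if Q [hd xs] then fst (prod_decode (hd xs)) else a)"
      unfolding One_nat_def
    proof (intro recursive_if recursive_fst recursive_const recursive_hd)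
      show "recursive_rel (Suc 0) (\<lambda>xs. Q [hd xs])"
        by (rule recursive_rel_comp_list[OF Q(1)]) (auto intro: recursive_hd)
    qed
    then have "recursive_fun f"
      by (auto intro!: recursive_funI simp: f_def)
    moreover have "A = range f"
    proof
      show "A \<subseteq> range f"
      proof
        fix v assume "v \<in> A"
        then obtain s where "Q [prod_encode (v, s)]" using Q by blast
        then have "f (prod_encode (v, s)) = v" by (simp add: f_def)
        then show "v \<in> range f" by (metis rangeI)
      qed
      show "range f \<subseteq> A"
        using a Q(2) by (auto simp: f_def) (metis prod.collapse prod_decode_inverse)
    qed
    ultimately show ?thesis by (auto simp: re_set_def)
  qed (simp add: re_set_def)
qed

lemma re_setI:
  assumes "\<And>v. v \<in> A \<longleftrightarrow> (\<exists>s. Q v s)"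
    and "recursive_rel 1 (\<lambda>xs. Q (fst (prod_decode (hd xs))) (snd (prod_decode (hd xs))))"
  shows "re_set A"
  unfolding re_set_ex_iff
  using assms
  by (intro exI[of _ "\<lambda>xs. Q (fst (prod_decode (hd xs))) (snd (prod_decode (hd xs)))"]) simp

section \<open>The prefix of a \<open>\<Sigma>\<^sub>3\<close> set\<close>

lemma sigma0_3_iff:
  "sigma0 3 A \<longleftrightarrow>
    (\<exists>R. recursive_rel 4 R \<and> (\<forall>x. x \<in> A \<longleftrightarrow> (\<exists>a. \<forall>b. \<exists>c. R [x, a, b, c])))"
  by (simp add: sigma0_def numeral_3_eq_3 numeral_eq_Suc)

lemma recursive_rel_comp4:
  assumes "recursive_rel 4 R"
    and "recursive n f" "recursive n g" "recursive n h" "recursive n k"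
  shows "recursive_rel n (\<lambda>xs. R [f xs, g xs, h xs, k xs])"
  by (rule recursive_rel_comp_list[OF assms(1)])
    (use assms(2-) in \<open>auto simp: less_Suc_eq numeral_eq_Suc\<close>)

text \<open>Contracts a block of universal quantifiers into one, since the prefix in
  \<open>sigma0\<close> has a single variable per block.\<close>

lemma all_prod_decode3:
  "(\<forall>v. P (fst (prod_decode v)) (fst (prod_decode (snd (prod_decode v))))
     (snd (prod_decode (snd (prod_decode v))))) \<longleftrightarrow> (\<forall>a b c. P a b c)"
  by (metis fst_conv snd_conv prod_encode_inverse)

text \<open>Finitely many witnesses have a common strict bound, here the successor of their sum. So
  an unbounded existential quantifier moves out of a bounded universal one.\<close>

lemma bounded_collection:
  fixes P :: "nat \<Rightarrow> nat \<Rightarrow> bool"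
  assumes "\<forall>b<m. \<exists>c. P b c"
  shows "\<exists>s. \<forall>b<m. \<exists>c<s. P b c"
proof -
  obtain c where c: "\<And>b. b < m \<Longrightarrow> P b (c b)" using assms by metis
  have "c b < Suc (\<Sum>b<m. c b)" if "b < m" for b
    using member_le_sum[of b "{..<m}" c] that by simp
  with c show ?thesis by blast
qed

lemma triple_mem_TDDP_iff:
  "triple e x d \<in> TDDP W \<longleftrightarrow> d \<ge> 1 \<and> (\<exists>u. card (set_decode u) \<le> d \<and>
     (\<forall>y. lang W e x \<noteq> lang W e y \<longrightarrow>
       lang W e x \<inter> set_decode u \<noteq> lang W e y \<inter> set_decode u))"
  by (auto simp: TDDP_def DS_def triple_def)

section \<open>Membership\<close>

text \<open>Each \<open>w\<close> in the finite set \<open>D\<close> enters each approximation at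
  most once and never leaves. As the limits agree on \<open>D\<close>, the approximations agree
  there from some stage \<open>T\<close> on, and past \<open>T\<close> only the second alternative
  of \<open>ex\<close> remains.\<close>

lemma approximations_subset:
  fixes A B :: "'a \<Rightarrow> nat \<Rightarrow> bool"
  assumes mono: "\<And>w. mono (A w)" "\<And>w. mono (B w)" and fin: "finite D"
    and eq: "{w. \<exists>t. A w t} \<inter> D = {w. \<exists>t. B w t} \<inter> D"
    and ex: "\<And>z s. \<exists>t\<ge>s. (\<exists>w\<in>D. A w t \<noteq> B w t) \<or> (A z s \<longrightarrow> B z t)"
  shows "{w. \<exists>t. A w t} \<subseteq> {w. \<exists>t. B w t}"
proof
  fix z assume "z \<in> {w. \<exists>t. A w t}"
  then obtain r where r: "A z r" by blast
  have "\<forall>\<^sub>F t in sequentially. \<forall>w\<in>D. A w t = B w t"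
  proof (intro eventually_ball_finite[OF fin] ballI)
    fix w assume "w \<in> D"
    show "\<forall>\<^sub>F t in sequentially. A w t = B w t"
    proof (cases "\<exists>t. A w t")
      case True
      then obtain p q where "A w p" "B w q" using eq \<open>w \<in> D\<close> by blast
      then have "A w t = B w t" if "t \<ge> max p q" for t
        using that mono[of w] by (auto dest: monoD[where x=p and y=t] monoD[where x=q and y=t])
      then show ?thesis unfolding eventually_sequentially by blast
    next
      case False
      moreover from this have "\<nexists>t. B w t" using eq \<open>w \<in> D\<close> by blast
      ultimately show ?thesis by simp
    qed
  qed
  then obtain T where T: "\<And>t. t \<ge> T \<Longrightarrow> \<forall>w\<in>D. A w t = B w t"
    unfolding eventually_sequentially by blast
  \<comment> \<open>The stage \<open>max r T\<close> is late enough for \<open>z\<close> to be in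
    the first approximation and for all differences on \<open>D\<close> to be gone.\<close>
  obtain t where "t \<ge> max r T" "(\<exists>w\<in>D. A w t \<noteq> B w t) \<or> (A z (max r T) \<longrightarrow> B z t)"
    using ex by blast
  moreover have "A z (max r T)" using r mono(1)[of z] by (auto dest: monoD[where x=r and y="max r T"])
  ultimately show "z \<in> {w. \<exists>t. B w t}" using T[of t] by auto
qed

text \<open>Trades equality and inequality of limits for a \<forall>\<exists> condition on stages.
  If the limits are equal, every element of one eventually shows up in the other; if they differ on
  \<open>D\<close>, the difference is eventually permanent. The converse is
  \<open>approximations_subset\<close> in both directions.\<close>

lemma distinguishes_iff:
  fixes A B :: "'a \<Rightarrow> nat \<Rightarrow> bool"
  assumes mono: "\<And>w. mono (A w)" "\<And>w. mono (B w)" and fin: "finite D"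
  defines "X \<equiv> {w. \<exists>t. A w t}" and "Y \<equiv> {w. \<exists>t. B w t}"
  shows "(X \<noteq> Y \<longrightarrow> X \<inter> D \<noteq> Y \<inter> D) \<longleftrightarrow>
    (\<forall>z s. \<exists>t\<ge>s. (\<exists>w\<in>D. A w t \<noteq> B w t) \<or> (A z s \<longrightarrow> B z t) \<and> (B z s \<longrightarrow> A z t))"
    (is "_ \<longleftrightarrow> ?R")
proof
  assume L: "X \<noteq> Y \<longrightarrow> X \<inter> D \<noteq> Y \<inter> D"
  show ?R
  proof (intro allI)
    fix z s
    have upA: "A w t" if "A w p" "p \<le> t" for w p t
      using that monoD[OF mono(1), of p t w] by simp
    have upB: "B w t" if "B w p" "p \<le> t" for w p t
      using that monoD[OF mono(2), of p t w] by simp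
    show "\<exists>t\<ge>s. (\<exists>w\<in>D. A w t \<noteq> B w t) \<or> (A z s \<longrightarrow> B z t) \<and> (B z s \<longrightarrow> A z t)"
    proof (cases "X = Y")
      case True
      then have "(\<exists>t. A z t) \<longleftrightarrow> (\<exists>t. B z t)" by (auto simp: X_def Y_def)
      \<comment> \<open>If \<open>z\<close> is in neither limit, any \<open>p\<close> works;
        otherwise \<open>p\<close> is a stage at which both approximations contain
        \<open>z\<close>.\<close>
      then obtain p where "(A z s \<longrightarrow> B z p) \<and> (B z s \<longrightarrow> A z p)"
        by (metis linorder_linear upA upB)
      then show ?thesis by (intro exI[of _ "max s p"]) (auto intro: upA upB)
    next
      case False
      then obtain w where w: "w \<in> D" "(\<exists>t. A w t) \<noteq> (\<exists>t. B w t)"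
        using L by (auto simp: X_def Y_def)
      then obtain p where "A w p \<noteq> B w p" "\<not> (\<exists>t. A w t) \<or> \<not> (\<exists>t. B w t)" by blast
      \<comment> \<open>One side never accepts \<open>w\<close> and the other keeps it, so the
        difference at \<open>p\<close> persists.\<close>
      then have "A w (max s p) \<noteq> B w (max s p)" by (metis max.cobounded2 upA upB)
      with w(1) show ?thesis by (meson max.cobounded1)
    qed
  qed
next
  assume ?R
  then have R: "\<exists>t\<ge>s. (\<exists>w\<in>D. A w t \<noteq> B w t) \<or> (A z s \<longrightarrow> B z t) \<and> (B z s \<longrightarrow> A z t)" for s z
    by blast
  show "X \<noteq> Y \<longrightarrow> X \<inter> D \<noteq> Y \<inter> D"
  proof (intro impI notI)
    assume "X \<noteq> Y" and eq: "X \<inter> D = Y \<inter> D"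
    have "X \<subseteq> Y" unfolding X_def Y_def
    proof (rule approximations_subset[OF mono fin eq[unfolded X_def Y_def]])
      show "\<exists>t\<ge>s. (\<exists>w\<in>D. A w t \<noteq> B w t) \<or> (A z s \<longrightarrow> B z t)" for z s
        using R[of s z] by blast
    qed
    moreover have "Y \<subseteq> X" unfolding X_def Y_def
    proof (rule approximations_subset[OF mono(2,1) fin eq[symmetric, unfolded X_def Y_def]])
      show "\<exists>t\<ge>s. (\<exists>w\<in>D. B w t \<noteq> A w t) \<or> (B z s \<longrightarrow> A z t)" for z s
        using R[of s z] by metis
    qed
    ultimately show False using \<open>X \<noteq> Y\<close> by simp
  qed
qed

lemma sigma0_TDDP:
  assumes "acceptable_numbering W"
  shows "sigma0 3 (TDDP W)"
proof -
  obtain Q where Q: "recursive_rel 1 Q"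
    "\<And>v. v \<in> {prod_encode (e, x) | e x. x \<in> W e} \<longleftrightarrow> (\<exists>s. Q [prod_encode (v, s)])"
    using assms unfolding acceptable_numbering_def re_set_ex_iff by blast
  \<comment> \<open>\<open>E e j z t\<close> says that \<open>z\<close> is seen in
    \<open>lang W e j\<close> before stage \<open>t\<close>; bounding the search by \<open>t\<close>
    makes it recursive and monotone in \<open>t\<close>.\<close>
  define E where
    "E = (\<lambda>e j z t. \<exists>s<t. Q [prod_encode (prod_encode (e, prod_encode (j, z)), s)])"
  have lang: "lang W e j = {z. \<exists>t. E e j z t}" for e j
    using Q(2)[of "prod_encode (e, prod_encode (j, _))"] by (auto simp: lang_def E_def)
  have mono: "mono (E e j z)" for e j z
    unfolding E_def by (intro monoI le_boolI) (meson less_le_trans)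
  have rec_E: "recursive_rel n (\<lambda>xs. E (e xs) (j xs) (z xs) (t xs))"
    if "recursive n e" "recursive n j" "recursive n z" "recursive n t" for n e j z t
  proof -
    have rec_Q: "recursive_rel k (\<lambda>xs. Q [f xs])" if "recursive k f" for k f
      by (rule recursive_rel_comp_list[OF Q(1)]) (use that in auto)
    show ?thesis
      unfolding E_def
      by (intro recursive_rel_ex rec_Q recursive_prod_encode recursive_tl recursive_hd that)
  qed
  define M where "M = (\<lambda>e j d u y z s t. d \<ge> 1 \<and> card (set_decode u) \<le> d \<and> s \<le> t \<and>
      ((\<exists>w<u. w \<in> set_decode u \<and> E e j w t \<noteq> E e y w t) \<or>
       (E e j z s \<longrightarrow> E e y z t) \<and> (E e y z s \<longrightarrow> E e j z t)))"
  \<comment> \<open>The four arguments are the code of the triple, \<open>u\<close>, a code for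
    \<open>y\<close>, \<open>z\<close>, \<open>s\<close> together, and the stage \<open>t\<close>.
    The conditions on \<open>d\<close> and \<open>u\<close> are recursive and may stay in the
    matrix.\<close>
  define R where "R = (\<lambda>xs. M
      (fst (prod_decode (xs ! 0))) (fst (prod_decode (snd (prod_decode (xs ! 0)))))
      (snd (prod_decode (snd (prod_decode (xs ! 0))))) (xs ! 1)
      (fst (prod_decode (xs ! 2))) (fst (prod_decode (snd (prod_decode (xs ! 2)))))
      (snd (prod_decode (snd (prod_decode (xs ! 2))))) (xs ! 3))"
  have "recursive_rel 4 R"
    unfolding R_def M_def
    by (intro recursive_rel_conj recursive_rel_disj recursive_rel_imp recursive_rel_not
        recursive_rel_iff recursive_rel_le recursive_rel_ex recursive_rel_set_decode rec_E
        recursive_card_set_decode recursive_const recursive_fst recursive_snd recursive_tl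
        recursive_hd recursive.proj) simp_all
  moreover have "x \<in> TDDP W \<longleftrightarrow> (\<exists>u. \<forall>v. \<exists>t. R [x, u, v, t])" for x
  proof -
    obtain e j d where x: "x = triple e j d"
      unfolding triple_def by (metis prod.collapse prod_decode_inverse)
    have "(\<exists>w<u. w \<in> set_decode u \<and> P w) \<longleftrightarrow> (\<exists>w\<in>set_decode u. P w)" for u P
      using set_decode_less by blast
    then have "(\<forall>v. \<exists>t. R [x, u, v, t]) \<longleftrightarrow> d \<ge> 1 \<and> card (set_decode u) \<le> d \<and>
        (\<forall>y z s. \<exists>t\<ge>s. (\<exists>w\<in>set_decode u. E e j w t \<noteq> E e y w t) \<or>
          (E e j z s \<longrightarrow> E e y z t) \<and> (E e y z s \<longrightarrow> E e j z t))" for u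
      unfolding R_def x triple_def
      by (simp add: all_prod_decode3[of "\<lambda>y z s. \<exists>t. M e j d u y z s t"])
        (auto simp: M_def)
    also have "\<dots> u \<longleftrightarrow> d \<ge> 1 \<and> card (set_decode u) \<le> d \<and>
        (\<forall>y. lang W e j \<noteq> lang W e y \<longrightarrow>
          lang W e j \<inter> set_decode u \<noteq> lang W e y \<inter> set_decode u)" for u
      unfolding lang distinguishes_iff[OF mono mono finite_set_decode] by simp
    finally show ?thesis
      unfolding x triple_mem_TDDP_iff by blast
  qed
  ultimately show ?thesis
    unfolding sigma0_3_iff by blast
qed

section \<open>Hardness\<close>

lemma many_one_reducible_TDDP:
  assumes "acceptable_numbering W" "sigma0 3 B"
  shows "many_one_reducible B (TDDP W)"
proof -
  obtain R where R: "recursive_rel 4 R" "\<And>x. x \<in> B \<longleftrightarrow> (\<exists>a. \<forall>b. \<exists>c. R [x, a, b, c])"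
    using assms(2) unfolding sigma0_3_iff by blast
  \<comment> \<open>Here \<open>Suc n = j\<close> puts \<open>j - 1\<close> into the set of index
    \<open>j > 0\<close>, and \<open>b<Suc n\<close> expresses \<open>b \<le> n\<close>.\<close>
  define L where "L = (\<lambda>x j. {n. j = 0 \<or> Suc n = j \<or> (\<exists>a<j. \<forall>b<Suc n. \<exists>c. R [x, a, b, c])})"
  \<comment> \<open>The coding matches both \<open>acceptable_numbering\<close> and
    \<open>lang\<close>, so the translation \<open>f\<close> gives
    \<open>lang W (f x) j = L x j\<close>.\<close>
  define V where "V = {v. snd (prod_decode (snd (prod_decode v)))
      \<in> L (fst (prod_decode v)) (fst (prod_decode (snd (prod_decode v))))}"
  \<comment> \<open>The stage version of \<open>L\<close>: bounding \<open>c\<close> by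
    \<open>s\<close> makes the condition recursive, and \<open>bounded_collection\<close> recovers
    \<open>L\<close> as its union over \<open>s\<close>.\<close>
  define Q where "Q = (\<lambda>x j n s. j = 0 \<or> Suc n = j \<or>
      (\<exists>a<j. \<forall>b<Suc n. \<exists>c<s. R [x, a, b, c]))"
  have "re_set V"
  proof (rule re_setI)
    show "v \<in> V \<longleftrightarrow> (\<exists>s. Q (fst (prod_decode v)) (fst (prod_decode (snd (prod_decode v))))
        (snd (prod_decode (snd (prod_decode v)))) s)" for v
    proof -
      have "n \<in> L x j \<longleftrightarrow> (\<exists>s. Q x j n s)" for x j n
      proof
        assume "n \<in> L x j"
        then consider "j = 0 \<or> Suc n = j" | a where "a < j" "\<forall>b<Suc n. \<exists>c. R [x, a, b, c]"
          unfolding L_def by blast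
        then show "\<exists>s. Q x j n s"
        proof cases
          case 2
          from bounded_collection[OF 2(2)]
          obtain s where "\<forall>b<Suc n. \<exists>c<s. R [x, a, b, c]" ..
          with \<open>a < j\<close> show ?thesis unfolding Q_def by blast
        qed (auto simp: Q_def)
      next
        assume "\<exists>s. Q x j n s"
        then show "n \<in> L x j" unfolding Q_def L_def by blast
      qed
      then show ?thesis by (simp add: V_def)
    qed
    have rec_Q: "recursive_rel m (\<lambda>xs. Q (x xs) (j xs) (n xs) (s xs))"
      if "recursive m x" "recursive m j" "recursive m n" "recursive m s" for m x j n s
      unfolding Q_def
      by (intro recursive_rel_disj recursive_rel_eq recursive_rel_ex recursive_rel_all
          recursive_rel_comp4[OF R(1)] recursive_Suc recursive_const recursive_hd recursive_tl that)
    show "recursive_rel 1 (\<lambda>xs. Q (fst (prod_decode (fst (prod_decode (hd xs)))))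
        (fst (prod_decode (snd (prod_decode (fst (prod_decode (hd xs)))))))
        (snd (prod_decode (snd (prod_decode (fst (prod_decode (hd xs)))))))
        (snd (prod_decode (hd xs))))"
      unfolding One_nat_def by (intro rec_Q recursive_fst recursive_snd recursive_hd)
  qed
  then obtain f where f: "recursive_fun f" "\<And>x. W (f x) = {z. prod_encode (x, z) \<in> V}"
    using assms(1) unfolding acceptable_numbering_def by blast
  then have lang: "lang W (f x) j = L x j" for x j
    by (auto simp: lang_def V_def)
  have fin: "finite (L x j)" if "L x j \<noteq> UNIV" for x j
  proof -
    from that obtain n where n: "n \<notin> L x j" by blast
    \<comment> \<open>Apart from the extra element \<open>j - 1\<close>, the set is downward closed,
      so a missing \<open>n\<close> bounds all other members.\<close>
    have "m < n \<or> m < j" if m: "m \<in> L x j" for m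
    proof (rule ccontr)
      assume "\<not> (m < n \<or> m < j)"
      then have "n \<le> m" "Suc m \<noteq> j" by auto
      moreover have "j \<noteq> 0" using n by (auto simp: L_def)
      ultimately obtain a where "a < j" "\<forall>b<Suc m. \<exists>c. R [x, a, b, c]"
        using m by (auto simp: L_def)
      then have "\<forall>b<Suc n. \<exists>c. R [x, a, b, c]" using \<open>n \<le> m\<close> by simp
      with \<open>a < j\<close> n show False unfolding L_def by blast
    qed
    then have "L x j \<subseteq> {..<n} \<union> {..<j}" by blast
    then show ?thesis using finite_subset by blast
  qed
  have univ: "L x 0 = UNIV" for x
    by (simp add: L_def)
  \<comment> \<open>The reduction always asks about index 0, whose set is everything, with the least
    admissible size 1.\<close>
  have "x \<in> B \<longleftrightarrow> (\<exists>u. card (set_decode u) \<le> 1 \<and>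
      (\<forall>y. L x 0 \<noteq> L x y \<longrightarrow> L x 0 \<inter> set_decode u \<noteq> L x y \<inter> set_decode u))" for x
  proof
    assume "x \<in> B"
    then obtain a where a: "\<forall>b. \<exists>c. R [x, a, b, c]" using R(2) by blast
    \<comment> \<open>Every index above \<open>a\<close> has \<open>a\<close> among its candidate
      witnesses and gives \<open>UNIV\<close>, so only indices up to \<open>a\<close> need to be
      avoided by \<open>z\<close>.\<close>
    have "finite (\<Union>y\<in>{y. y \<le> a \<and> L x y \<noteq> UNIV}. L x y)"
      using fin by simp
    then obtain z where z: "z \<notin> (\<Union>y\<in>{y. y \<le> a \<and> L x y \<noteq> UNIV}. L x y)"
      using ex_new_if_finite infinite_UNIV_nat by blast
    have "z \<notin> L x y" if "L x y \<noteq> UNIV" for y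
    proof (cases "y \<le> a")
      case True
      then show ?thesis using z that by blast
    next
      case False
      then have "a < y" by simp
      with a have "L x y = UNIV" unfolding L_def by blast
      with that show ?thesis by simp
    qed
    then show "\<exists>u. card (set_decode u) \<le> 1 \<and>
        (\<forall>y. L x 0 \<noteq> L x y \<longrightarrow> L x 0 \<inter> set_decode u \<noteq> L x y \<inter> set_decode u)"
      \<comment> \<open>\<open>set_encode {z}\<close> is the canonical index of the singleton, which
        meets \<open>UNIV\<close> but none of the proper sets.\<close>
      unfolding univ by (intro exI[of _ "set_encode {z}"]) (auto simp del: set_encode_insert)
  next
    assume "\<exists>u. card (set_decode u) \<le> 1 \<and>
        (\<forall>y. L x 0 \<noteq> L x y \<longrightarrow> L x 0 \<inter> set_decode u \<noteq> L x y \<inter> set_decode u)"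
    then obtain u where card: "card (set_decode u) \<le> 1"
      and u: "\<And>y. L x y \<noteq> UNIV \<Longrightarrow> set_decode u \<noteq> L x y \<inter> set_decode u"
      unfolding univ by auto
    obtain z where z: "set_decode u \<subseteq> {z}"
      using card card_le_Suc0_iff_eq[of "set_decode u"] by auto blast
    have "z \<in> L x (Suc z)" by (simp add: L_def)
    \<comment> \<open>\<open>L x (Suc z)\<close> contains \<open>z\<close>, hence agrees with
      \<open>UNIV\<close> on \<open>set_decode u\<close> and cannot be a proper subset.\<close>
    with u[of "Suc z"] z have full: "L x (Suc z) = UNIV" by blast
    show "x \<in> B"
    proof (rule ccontr)
      assume "x \<notin> B"
      then have "\<forall>a<Suc z. \<exists>b. \<forall>c. \<not> R [x, a, b, c]" using R(2) by blast
      from bounded_collection[OF this]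
      obtain s where s: "\<forall>a<Suc z. \<exists>b<s. \<forall>c. \<not> R [x, a, b, c]" ..
      \<comment> \<open>This number exceeds \<open>z\<close>, so it is not the extra element, and it
        exceeds \<open>s\<close>, so every candidate \<open>a \<le> z\<close> meets its failing
        \<open>b\<close> below it.\<close>
      have "Suc (s + z) \<notin> L x (Suc z)"
      proof
        assume "Suc (s + z) \<in> L x (Suc z)"
        then obtain a where a: "a < Suc z" "\<forall>b<Suc (Suc (s + z)). \<exists>c. R [x, a, b, c]"
          by (auto simp: L_def)
        obtain b where "b < s" "\<forall>c. \<not> R [x, a, b, c]" using s a(1) by blast
        with a(2) show False by (meson less_SucI trans_less_add1)
      qed
      with full show False by blast
    qed
  qed
  then have "x \<in> B \<longleftrightarrow> triple (f x) 0 1 \<in> TDDP W" for x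
    by (simp add: triple_mem_TDDP_iff lang)
  moreover have "recursive_fun (\<lambda>x. triple (f x) 0 1)"
    unfolding triple_def
    by (intro recursive_funI, unfold One_nat_def)
      (intro recursive_prod_encode recursive_comp_fun[OF f(1)] recursive_const recursive_hd)
  ultimately show ?thesis
    unfolding many_one_reducible_def by blast
qed

theorem theorem3:
  fixes W :: "nat \<Rightarrow> nat set"
  assumes "acceptable_numbering W"
  shows "sigma0_complete 3 (TDDP W)"
  using assms by (simp add: sigma0_complete_def sigma0_TDDP many_one_reducible_TDDP)

end
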